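(* Let $x$ be a positive integer and for $k\geq 1$ let $$F_k(x):=\left[x,\frac{1}{x},x^2,\frac{1}{x^2},x^3,\frac{1}{x^3},\dots,x^k,\frac{1}{x^k}\right]$$ and $$F_k^{*}(x):=\left[x,\frac{1}{x},x^2,\frac{1}{x^2},x^3,\frac{1}{x^3},\dots,x^{k-1},\frac{1}{x^{k-1}},x^k\right].$$ Then, as $k\to\infty$, both $F_k(x)$ and $F_k^{*}(x)$ converge to the positive root (in $z$) of $P(x,z)=z^2-(2x-1)z-x$.
   Context: For positive real numbers $b_0,b_1,\dots,b_n$, the notation $[b_0,b_1,\dots,b_n]$ denotes the finite continued fraction $b_0+\cfrac{1}{b_1+\cfrac{1}{b_2+\cdots+\cfrac{1}{b_n}}}$; the partial quotients need not be integers. $F_k(x)$ has $2k$ partial quotients, and $F_k^*(x)$ has $2k-1$ partial quotients (it is $F_k(x)$ with the last partial quotient $1/x^k$ removed; in particular $F_1^*(x)=[x]=x$). They are the odd-indexed and even-indexed convergents, respectively, of the infinite continued fraction $[x,\frac1x,x^2,\frac1{x^2},x^3,\frac{1}{x^3},\dots]$, with convergents indexed from $0$. *)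

theory Defs
  imports "HOL-Analysis.Analysis"
begin

text \<open>
  The finite continued fraction with real partial quotients in the list. The notation is only
  meaningful for nonempty lists; the value at the empty list is a dummy.
\<close>

fun cfrac :: "real list \<Rightarrow> real" where
  "cfrac [] = 0"
| "cfrac [b] = b"
| "cfrac (b # c # bs) = b + 1 / cfrac (c # bs)"

definition F :: "real \<Rightarrow> nat \<Rightarrow> real" where
  "F x k = cfrac (concat (map (\<lambda>j. [x ^ j, 1 / x ^ j]) [1..<Suc k]))"

text \<open>Both \<open>F x k\<close> and \<open>F_star x k\<close> are meant for \<open>k \<ge> 1\<close>.\<close>

definition F_star :: "real \<Rightarrow> nat \<Rightarrow> real" where
  "F_star x k = cfrac (concat (map (\<lambda>j. [x ^ j, 1 / x ^ j]) [1..<k]) @ [x ^ k])"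

definition P :: "real \<Rightarrow> real \<Rightarrow> real" where
  "P x z = z\<^sup>2 - (2 * x - 1) * z - x"

end

theory Submission
  imports Defs
begin

text \<open>
  Multiplying a continued fraction by \<open>x\<close> multiplies its partial quotients alternately by \<open>x\<close> and
  \<open>1 / x\<close>, so removing the first two partial quotients of \<open>F x (k + 1)\<close> leaves \<open>x * F x k\<close>, and
  likewise for \<open>F_star\<close>. Hence both sequences are orbits of \<open>g y = x + x * y / (y + 1)\<close>, whose
  positive fixed point is the positive root of \<open>P x\<close>; this fixed point is at least \<open>x\<close>, so each
  step of a positive orbit shrinks the distance to it by a factor of at most \<open>x / (x + 1)\<close>.
\<close>

text \<open>The case \<open>bs = []\<close> relies on \<open>1 / 0 = 0\<close>.\<close>

lemma cfrac_Cons: "cfrac (b # bs) = b + 1 / cfrac bs"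
  by (cases bs) auto

text \<open>The optional last entry \<open>bs\<close> lets one induction serve both \<open>F\<close>
  (\<open>bs = []\<close>) and \<open>F_star\<close> (\<open>bs = [x ^ k]\<close>).\<close>

lemma cfrac_scale:
  assumes "x \<noteq> 0" "length bs \<le> 1"
  shows "cfrac (concat (map (\<lambda>j. [x ^ Suc j, 1 / x ^ Suc j]) js) @ map ((*) x) bs) =
         x * cfrac (concat (map (\<lambda>j. [x ^ j, 1 / x ^ j]) js) @ bs)"
proof (induction js)
  case Nil
  from assms(2) show ?case by (cases bs) auto
next
  case (Cons j js)
  define c where "c = cfrac (concat (map (\<lambda>j. [x ^ j, 1 / x ^ j]) js) @ bs)"
  \<comment> \<open>Also covers \<open>c = 0\<close>, the value at the empty list, since
    \<open>1 / 0 = 0\<close>.\<close>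
  have "1 / x ^ Suc j + 1 / (x * c) = (1 / x ^ j + 1 / c) / x"
    using assms by (simp add: add_divide_distrib mult.commute)
  with Cons show ?case
    by (simp add: cfrac_Cons c_def [symmetric] distrib_left del: power_Suc) simp
qed

lemma cfrac_step:
  assumes "x > 0" "y > 0"
  shows "cfrac [x, 1 / x, x * y] = x + x * y / (y + (1::real))"
  using assms by (simp add: field_simps)

lemma F_Suc:
  assumes "x > 0" "F x k > 0"
  shows "F x (Suc k) = x + x * F x k / (F x k + 1)"
proof -
  \<comment> \<open>Splitting off exponent 1 leaves exponents shifted by one, the form that
    \<open>cfrac_scale\<close> handles.\<close>
  have "[1..<Suc (Suc k)] = 1 # map Suc [1..<Suc k]"
    by (simp add: upt_conv_Cons map_Suc_upt del: upt_Suc)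
  then have "F x (Suc k) = x + 1 / (1 / x + 1 / (x * F x k))"
    using cfrac_scale [of x "[]" "[1..<Suc k]"] assms
    by (simp add: F_def cfrac_Cons comp_def del: upt_Suc)
  with cfrac_step [OF assms] show ?thesis by simp
qed

lemma F_star_Suc:
  assumes "x > 0" "k \<ge> 1" "F_star x k > 0"
  shows "F_star x (Suc k) = x + x * F_star x k / (F_star x k + 1)"
proof -
  have "[1..<Suc k] = 1 # map Suc [1..<k]"
    using assms by (simp add: upt_conv_Cons map_Suc_upt del: upt_Suc)
  then have "F_star x (Suc k) = x + 1 / (1 / x + 1 / (x * F_star x k))"
    using cfrac_scale [of x "[x ^ k]" "[1..<k]"] assms
    by (simp add: F_star_def cfrac_Cons comp_def del: upt_Suc)
  with cfrac_step [OF assms(1,3)] show ?thesis by simp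
qed

lemma P_root_iff_fixed_point:
  assumes "z > 0"
  shows "P x z = 0 \<longleftrightarrow> z = x + x * z / (z + 1)"
  using assms by (simp add: P_def field_simps power2_eq_square)

lemma P_positive_root_exists:
  assumes "x > 0"
  obtains z where "z > 0" "P x z = 0"
proof
  \<comment> \<open>The discriminant of \<open>P x\<close> is (2x - 1)^2 + 4x = 4x^2 + 1.\<close>
  define s where "s = sqrt (4 * x\<^sup>2 + 1)"
  have s: "s\<^sup>2 = 4 * x\<^sup>2 + 1" by (simp add: s_def)
  have "s > 1" using assms by (simp add: s_def)
  with assms show "(2 * x - 1 + s) / 2 > 0" by simp
  show "P x ((2 * x - 1 + s) / 2) = 0"
    using s by (simp add: P_def power2_eq_square field_simps)
qed

text \<open>Orbits start at index 1: the dummy value \<open>F_star x 0 = 1\<close> does not fit the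
  recursion.\<close>

lemma orbit_tendsto_root:
  fixes u :: "nat \<Rightarrow> real"
  assumes x: "x > 0" and z: "z > 0" "P x z = 0"
    and u1: "u 1 > 0"
    and step: "\<And>k. k \<ge> 1 \<Longrightarrow> u k > 0 \<Longrightarrow> u (Suc k) = x + x * u k / (u k + 1)"
  shows "u \<longlonglongrightarrow> z"
proof -
  define q where "q = x / (x + 1)"
  have fixed: "z = x + x * z / (z + 1)"
    using P_root_iff_fixed_point z by blast
  have "x * z / (z + 1) \<ge> 0" using x z by simp
  with fixed have "z \<ge> x" by linarith
  have pos: "u (Suc n) > 0" for n
  proof (induction n)
    case (Suc n)
    then have "x * u (Suc n) / (u (Suc n) + 1) > 0" using x by simp
    with Suc x show ?case by (simp add: step add_pos_pos)
  qed (use u1 in simp)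
  have contract: "\<bar>u (Suc (Suc n)) - z\<bar> \<le> q * \<bar>u (Suc n) - z\<bar>" for n
  proof -
    define a where "a = u (Suc n)"
    have a: "a > 0" using pos a_def by simp
    have "u (Suc (Suc n)) - z = x * a / (a + 1) - x * z / (z + 1)"
      using step [of "Suc n"] pos fixed by (simp add: a_def)
    \<comment> \<open>The difference quotient of y/(y + 1) between \<open>a\<close> and
      \<open>z\<close> is 1/((a + 1)(z + 1)).\<close>
    also have "\<dots> = x / ((a + 1) * (z + 1)) * (a - z)"
      using a z by (simp add: field_simps)
    finally have "\<bar>u (Suc (Suc n)) - z\<bar> = x / ((a + 1) * (z + 1)) * \<bar>a - z\<bar>"
      using a x z by (simp add: abs_mult)
    moreover have "1 * (x + 1) \<le> (a + 1) * (z + 1)"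
      using a x \<open>z \<ge> x\<close> by (intro mult_mono) auto
    then have "x / ((a + 1) * (z + 1)) \<le> q"
      using x by (auto simp: q_def intro!: divide_left_mono)
    ultimately show ?thesis
      unfolding a_def by (simp only: mult_right_mono abs_ge_zero)
  qed
  have q: "0 \<le> q" "q < 1" using x by (auto simp: q_def)
  have bound: "norm (u (Suc n) - z) \<le> \<bar>u 1 - z\<bar> * q ^ n" for n
  proof (induction n)
    case (Suc n)
    have "q * \<bar>u (Suc n) - z\<bar> \<le> q * (\<bar>u 1 - z\<bar> * q ^ n)"
      using Suc q by (intro mult_left_mono) auto
    with contract [of n] show ?case by (simp add: mult_ac)
  qed simp
  have "(\<lambda>n. \<bar>u 1 - z\<bar> * q ^ n) \<longlonglongrightarrow> 0"
    using q by (intro tendsto_mult_right_zero LIMSEQ_power_zero) auto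
  then have "(\<lambda>n. u (Suc n) - z) \<longlonglongrightarrow> 0"
    by (rule Lim_null_comparison [OF eventuallyI [OF bound]])
  then have "(\<lambda>n. u (Suc n)) \<longlonglongrightarrow> z" by (rule LIM_zero_cancel)
  then show ?thesis by (simp only: filterlim_sequentially_Suc)
qed

theorem theorem15:
  fixes x :: nat
  assumes "x > 0"
  shows "\<exists>z. (0 < z \<and> P (real x) z = 0) \<and>
             (\<forall>w. 0 < w \<and> P (real x) w = 0 \<longrightarrow> w = z) \<and>
             (\<lambda>k. F (real x) k) \<longlonglongrightarrow> z \<and>
             (\<lambda>k. F_star (real x) k) \<longlonglongrightarrow> z"
proof -
  have x: "real x > 0" using assms by simp
  obtain z where z: "z > 0" "P (real x) z = 0"
    using P_positive_root_exists [OF x] .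
  note lim = orbit_tendsto_root [OF x z]
  have unique: "w = z" if w: "w > 0" "P (real x) w = 0" for w
  proof -
    \<comment> \<open>A positive root \<open>w\<close> is a fixed point, so the constant sequence
      \<open>w\<close> is itself an orbit and must tend to \<open>z\<close>.\<close>
    have "(\<lambda>_. w) \<longlonglongrightarrow> z"
      using w P_root_iff_fixed_point by (intro lim) auto
    then show ?thesis by (simp add: LIMSEQ_const_iff)
  qed
  have "F (real x) 1 > 0" using x by (simp add: F_def)
  then have F: "F (real x) \<longlonglongrightarrow> z" using F_Suc [OF x] by (intro lim)
  have "F_star (real x) 1 > 0" using x by (simp add: F_star_def)
  then have "F_star (real x) \<longlonglongrightarrow> z" using F_star_Suc [OF x] by (intro lim)
  with z unique F show ?thesis by blast
qed

end
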